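(* Let $1<p,s<\infty$, $n\ge2$, let $\Omega\subseteq\mathbb{R}^n$ be a domain, let $a=(a_1,\dots,a_n)$ be a weight vector as in the context, and put $m=\min\{s,2\}$ and $M=\max\{s,2\}$. Then there exist positive constants $c(p,s)$ and $C(p,s)$, depending only on $p$ and $s$, such that for almost all $x\in\Omega$ and all $\xi,\eta\in\mathbb{R}^n$, $$c(p,s)\,|\eta|_{s,a}^{M}\left(|\eta|_{s,a}+|\xi|_{s,a}\right)^{p-M}\le D_{|\cdot|_{s,a}^{p}}(\xi+\eta,\xi)\le C(p,s)\,|\eta|_{s,a}^{m}\left(|\eta|_{s,a}+|\xi|_{s,a}\right)^{p-m}.$$
   Context: The functions $a_1,\dots,a_n:\Omega\to(0,\infty)$ are Lebesgue measurable and locally equivalent to $1$: for every domain $\omega$ whose closure is a compact subset of $\Omega$ there are constants $0<c_\omega\le C_\omega<\infty$ with $c_\omega\le a_i\le C_\omega$ a.e. in $\omega$. For almost all $x\in\Omega$ and $\xi\in\mathbb{R}^n$, $|\xi|_{s,a}=\left(\sum_{i=1}^n a_i(x)|\xi_i|^s\right)^{1/s}$. The Bregman distance of $|\cdot|_{s,a}^p$ is $$D_{|\cdot|_{s,a}^{p}}(\xi+\eta,\xi)=|\xi+\eta|_{s,a}^{p}-|\xi|_{s,a}^{p}-p|\xi|_{s,a}^{p-s}\sum_{i=1}^{n}a_{i}(x)|\xi_{i}|^{s-2}\xi_{i}\eta_{i},$$ where the last term is $0$ if $\xi=0$ and $|t|^{s-2}t=0$ for $t=0$. Expressions $|\eta|_{s,a}^{l}(|\eta|_{s,a}+|\xi|_{s,a})^{p-l}$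 are understood as $0$ when $\xi=\eta=0$. *)

theory Defs
  imports "HOL-Analysis.Analysis"
begin

text \<open>
  The constants of the theorem must not depend on the dimension, so the dimension has to be
  quantified below the existential quantifier and cannot be encoded as an index type. Hence
  \<open>\<real>\<^sup>n\<close> is the set of functions \<open>nat \<Rightarrow> real\<close> that are extensional on the index set \<open>{..<n}\<close>
  (coordinates are numbered from 0), with the product topology of the real line and the
  completion of the product of \<open>n\<close> copies of one-dimensional Lebesgue measure.
\<close>

definition Rn :: "nat \<Rightarrow> (nat \<Rightarrow> real) set" where
  "Rn n = {..<n} \<rightarrow>\<^sub>E UNIV"

definition Rn_top :: "nat \<Rightarrow> (nat \<Rightarrow> real) topology" where
  "Rn_top n = product_topology (\<lambda>_. euclideanreal) {..<n}"

definition Rn_leb :: "nat \<Rightarrow> (nat \<Rightarrow> real) measure" where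
  "Rn_leb n = completion (\<Pi>\<^sub>M i\<in>{..<n}. lborel)"

definition Rn_add :: "nat \<Rightarrow> (nat \<Rightarrow> real) \<Rightarrow> (nat \<Rightarrow> real) \<Rightarrow> (nat \<Rightarrow> real)" where
  "Rn_add n \<xi> \<eta> = (\<lambda>i\<in>{..<n}. \<xi> i + \<eta> i)"

lemma topspace_Rn_top: "topspace (Rn_top n) = Rn n"
  by (simp add: Rn_top_def Rn_def)

lemma space_Rn_leb: "space (Rn_leb n) = Rn n"
  by (simp add: Rn_leb_def Rn_def space_PiM)

definition is_domain :: "nat \<Rightarrow> (nat \<Rightarrow> real) set \<Rightarrow> bool" where
  "is_domain n \<Omega> \<longleftrightarrow> \<Omega> \<noteq> {} \<and> openin (Rn_top n) \<Omega> \<and> connectedin (Rn_top n) \<Omega>"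

text \<open>
  Only the values \<open>a i x\<close> with \<open>i < n\<close> and \<open>x \<in> \<Omega>\<close> are constrained.
\<close>

definition weight_vector ::
    "nat \<Rightarrow> (nat \<Rightarrow> real) set \<Rightarrow> (nat \<Rightarrow> (nat \<Rightarrow> real) \<Rightarrow> real) \<Rightarrow> bool" where
  "weight_vector n \<Omega> a \<longleftrightarrow>
     (\<forall>i<n. a i \<in> borel_measurable (restrict_space (Rn_leb n) \<Omega>)) \<and>
     (\<forall>i<n. \<forall>x\<in>\<Omega>. 0 < a i x) \<and>
     (\<forall>\<omega>. is_domain n \<omega> \<and> compactin (Rn_top n) (Rn_top n closure_of \<omega>) \<and>
           Rn_top n closure_of \<omega> \<subseteq> \<Omega> \<longrightarrow>
        (\<exists>c C. 0 < c \<and> c \<le> C \<and>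
           (\<forall>i<n. AE x\<in>\<omega> in Rn_leb n. c \<le> a i x \<and> a i x \<le> C)))"

definition wnorm ::
    "nat \<Rightarrow> real \<Rightarrow> (nat \<Rightarrow> (nat \<Rightarrow> real) \<Rightarrow> real) \<Rightarrow> (nat \<Rightarrow> real) \<Rightarrow> (nat \<Rightarrow> real) \<Rightarrow> real" where
  "wnorm n s a x \<xi> = (\<Sum>i<n. a i x * \<bar>\<xi> i\<bar> powr s) powr (1 / s)"

text \<open>
  Since \<open>0 powr r = 0\<close> for every \<open>r\<close>, the last term of the Bregman distance is \<open>0\<close> at \<open>\<xi> = 0\<close>,
  \<open>\<bar>t\<bar> powr (s - 2) * t\<close> is \<open>0\<close> at \<open>t = 0\<close>, and
  \<open>|\<eta>| powr l * (|\<eta>| + |\<xi>|) powr (p - l)\<close> is \<open>0\<close> at \<open>\<xi> = \<eta> = 0\<close>, as required.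
\<close>

definition bregman ::
    "nat \<Rightarrow> real \<Rightarrow> real \<Rightarrow> (nat \<Rightarrow> (nat \<Rightarrow> real) \<Rightarrow> real) \<Rightarrow> (nat \<Rightarrow> real) \<Rightarrow>
     (nat \<Rightarrow> real) \<Rightarrow> (nat \<Rightarrow> real) \<Rightarrow> real" where
  "bregman n p s a x \<zeta> \<xi> =
     wnorm n s a x \<zeta> powr p - wnorm n s a x \<xi> powr p
     - p * wnorm n s a x \<xi> powr (p - s) *
         (\<Sum>i<n. a i x * (\<bar>\<xi> i\<bar> powr (s - 2) * \<xi> i) * (\<zeta> i - \<xi> i))"

end

theory Submission
  imports Defs "HOL-Real_Asymp.Real_Asymp"
begin

text \<open>
  After absorbing the weights into the vectors, only finite \<open>\<ell>\<^sup>s\<close> norms remain, and by homogeneity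
  \<open>|\<xi>| = 1\<close>. For \<open>p = s\<close> the Bregman distance is a sum of scalar ones, each comparable to
  \<open>h\<^sup>2 (|t| + |h|)\<close> to the power \<open>s - 2\<close>, and elementary splittings compare that sum with
  powers of \<open>|\<eta>|\<close>. For general \<open>p\<close> put \<open>r = |\<xi> + \<eta>|\<close> and let \<open>L \<le> r\<close> be the pairing of \<open>\<xi> + \<eta>\<close>
  with the norming functional of \<open>\<xi>\<close>. The Bregman distance is then the scalar one between
  \<open>r\<close> and \<open>1\<close> plus \<open>p (r - L)\<close>. For bounded \<open>r\<close> the scalar parts for \<open>p\<close> and for \<open>s\<close> are both
  comparable to \<open>(r - 1)\<^sup>2\<close>, so the two distances are comparable; for large \<open>\<eta>\<close> the distance is
  comparable to \<open>|\<eta>|\<close> to the power \<open>p\<close>.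
\<close>

section \<open>Scalar Bregman distances of powers\<close>

text \<open>The Bregman distance of \<open>\<bar>t\<bar> powr s\<close>, parametrised by the
  increment \<open>h\<close> instead of the second point because all later bounds are in terms of
  increments.\<close>

definition powr_bregman :: "real \<Rightarrow> real \<Rightarrow> real \<Rightarrow> real" where
  "powr_bregman s t h = \<bar>t + h\<bar> powr s - \<bar>t\<bar> powr s - s * (\<bar>t\<bar> powr (s - 2) * t) * h"

lemma powr_bregman_one:
  "powr_bregman s 1 h = \<bar>1 + h\<bar> powr s - 1 - s * h"
  by (simp add: powr_bregman_def)

text \<open>If \<open>1 + h \<le> 0\<close>, the tangent value \<open>1 + s * h\<close> is already
  negative. Otherwise \<open>y powr s - s * y\<close> has its strict minimum over the positive axis
  at \<open>1\<close>. Strictness makes the quotient below positive.\<close>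

lemma powr_bregman_one_pos:
  assumes s: "1 < s" and h: "h \<noteq> 0"
  shows "0 < powr_bregman s 1 h"
proof (cases "1 + h \<le> 0")
  case True
  have "s * 1 \<le> s * - h"
    by (rule mult_left_mono) (use True s in auto)
  moreover have "0 \<le> \<bar>1 + h\<bar> powr s"
    by simp
  ultimately show ?thesis
    unfolding powr_bregman_one using s by linarith
next
  case False
  define f where "f = (\<lambda>y::real. y powr s - s * y)"
  have D: "(f has_real_derivative (s * (y powr (s - 1) - 1))) (at y)" if "0 < y" for y
    unfolding f_def using that s
    by (auto intro!: derivative_eq_intros simp: algebra_simps powr_diff)
  have "f 1 < f (1 + h)"
  proof (cases "h < 0")
    case True
    show ?thesis
    proof (rule DERIV_neg_imp_decreasing_open[where f = f])
      show "1 + h < 1" using True by simp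
      show "\<exists>y'. (f has_real_derivative y') (at y) \<and> y' < 0" if "1 + h < y" "y < 1" for y
      proof (intro exI conjI)
        show "(f has_real_derivative (s * (y powr (s - 1) - 1))) (at y)"
          using that False by (intro D) auto
        have "y powr (s - 1) < 1 powr (s - 1)"
          using that False s by (intro powr_less_mono2) auto
        then show "s * (y powr (s - 1) - 1) < 0"
          using s by (simp add: mult_less_0_iff)
      qed
      show "continuous_on {1 + h..1} f"
        using False by (intro DERIV_continuous_on[OF has_field_derivative_at_within[OF D]]) auto
    qed
  next
    case h': False
    show ?thesis
    proof (rule DERIV_pos_imp_increasing_open[where f = f])
      show "1 < 1 + h" using h h' by simp
      show "\<exists>y'. (f has_real_derivative y') (at y) \<and> 0 < y'" if "1 < y" "y < 1 + h" for y
      proof (intro exI conjI)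
        show "(f has_real_derivative (s * (y powr (s - 1) - 1))) (at y)"
          using that by (intro D) auto
        have "1 powr (s - 1) < y powr (s - 1)"
          using that s by (intro powr_less_mono2) auto
        then show "0 < s * (y powr (s - 1) - 1)"
          using s by simp
      qed
      show "continuous_on {1..1 + h} f"
        by (intro DERIV_continuous_on[OF has_field_derivative_at_within[OF D]]) auto
    qed
  qed
  then show ?thesis
    using False by (simp add: f_def powr_bregman_one algebra_simps)
qed

text \<open>The quotient of the two sides extends to a positive continuous function on the real line with
  limit \<open>1\<close> at both infinities.\<close>
lemma powr_bregman_one_bounds:
  assumes s: "1 < s"
  obtains c C where "0 < c" "0 < C"
    "\<And>h. c * (h\<^sup>2 * (1 + \<bar>h\<bar>) powr (s - 2)) \<le> powr_bregman s 1 h"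
    "\<And>h. powr_bregman s 1 h \<le> C * (h\<^sup>2 * (1 + \<bar>h\<bar>) powr (s - 2))"
proof -
  define w where "w h = h\<^sup>2 * (1 + \<bar>h\<bar>) powr (s - 2)" for h :: real
  \<comment> \<open>The value at \<open>0\<close> is half the second derivative of
    \<open>y powr s\<close> at \<open>1\<close>; by Taylor expansion it makes \<open>q\<close>
    continuous there.\<close>
  define q where "q = (\<lambda>h. if h = 0 then s * (s - 1) / 2 else powr_bregman s 1 h / w h)"
  have w_pos: "0 < w h" if "h \<noteq> 0" for h
    using that by (simp add: w_def)
  have q_pos: "0 < q h" for h
    using s powr_bregman_one_pos[OF s] w_pos by (simp add: q_def)
  \<comment> \<open>On each side of \<open>0\<close> and near each infinity the absolute values have
    a fixed sign, so every limit is computed without them and then transferred.\<close>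
  have 1: "((\<lambda>h. ((1+h) powr s - 1 - s*h)/(h^2*(1+h) powr (s-2))) \<longlongrightarrow> s*(s-1)/2) (at_right 0)"
    using s by real_asymp
  have R: "((\<lambda>h. powr_bregman s 1 h / w h) \<longlongrightarrow> s*(s-1)/2) (at_right 0)"
  proof (rule Lim_transform_eventually[OF 1])
    have "\<forall>\<^sub>F h in at_right 0. (0::real) < h"
      by real_asymp
    then show "\<forall>\<^sub>F h in at_right 0. ((1+h) powr s - 1 - s*h)/(h^2*(1+h) powr (s-2))
        = powr_bregman s 1 h / w h"
      by eventually_elim (simp add: powr_bregman_one w_def)
  qed
  have 2: "((\<lambda>h. ((1+h) powr s - 1 - s*h)/(h^2*(1-h) powr (s-2))) \<longlongrightarrow> s*(s-1)/2) (at_left 0)"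
    using s by real_asymp
  have L: "((\<lambda>h. powr_bregman s 1 h / w h) \<longlongrightarrow> s*(s-1)/2) (at_left 0)"
  proof (rule Lim_transform_eventually[OF 2])
    have "\<forall>\<^sub>F h in at_left 0. (h::real) < 0" "\<forall>\<^sub>F h in at_left 0. (-1::real) < h"
      by real_asymp+
    then show "\<forall>\<^sub>F h in at_left 0. ((1+h) powr s - 1 - s*h)/(h^2*(1-h) powr (s-2))
        = powr_bregman s 1 h / w h"
      by eventually_elim (simp add: powr_bregman_one w_def)
  qed
  have 3: "((\<lambda>h. ((1+h) powr s - 1 - s*h)/(h^2*(1+h) powr (s-2))) \<longlongrightarrow> 1) at_top"
    using s by real_asymp
  have T: "(q \<longlongrightarrow> 1) at_top"
  proof (rule Lim_transform_eventually[OF 3])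
    show "\<forall>\<^sub>F h in at_top. ((1+h) powr s - 1 - s*h)/(h^2*(1+h) powr (s-2)) = q h"
      using eventually_gt_at_top[of 0]
      by eventually_elim (simp add: powr_bregman_one w_def q_def)
  qed
  have 4: "((\<lambda>h. ((-1-h) powr s - 1 - s*h)/(h^2*(1-h) powr (s-2))) \<longlongrightarrow> 1) at_bot"
    using s by real_asymp
  have e: "\<forall>\<^sub>F h in at_bot. h < (-1::real)"
    by real_asymp
  have B: "(q \<longlongrightarrow> 1) at_bot"
  proof (rule Lim_transform_eventually[OF 4])
    show "\<forall>\<^sub>F h in at_bot. ((-1-h) powr s - 1 - s*h)/(h^2*(1-h) powr (s-2)) = q h"
      using e by eventually_elim (simp add: powr_bregman_one w_def q_def abs_if)
  qed
  have "continuous_on UNIV q"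
  proof (rule continuous_at_imp_continuous_on, intro ballI)
    fix x :: real
    show "isCont q x"
    proof (cases "x = 0")
      case True
      have "((\<lambda>h. powr_bregman s 1 h / w h) \<longlongrightarrow> s*(s-1)/2) (at 0)"
        using L R by (simp add: filterlim_split_at)
      then have "(q \<longlongrightarrow> s*(s-1)/2) (at 0)"
        by (rule Lim_transform_eventually)
           (auto simp: eventually_at_filter q_def)
      then show ?thesis
        using True by (simp add: isCont_def q_def)
    next
      case False
      have "\<forall>\<^sub>F y in nhds x. y \<noteq> 0"
        using False by (rule t1_space_nhds)
      then have ev: "\<forall>\<^sub>F y in nhds x. powr_bregman s 1 y / w y = q y"
        by eventually_elim (simp add: q_def)
      \<comment> \<open>At \<open>x = -1\<close> the base \<open>\<bar>1 + y\<bar>\<close> vanishes;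
        the power is continuous there because its exponent \<open>s\<close> is positive.\<close>
      have "isCont (\<lambda>y. powr_bregman s 1 y / w y) x"
        unfolding powr_bregman_one w_def isCont_def using False s
        by (intro tendsto_intros tendsto_powr') auto
      then show ?thesis
        using isCont_cong[OF ev] by simp
    qed
  qed
  have "\<forall>\<^sub>F h in at_top. 1/2 < q h \<and> q h < 2"
    using order_tendstoD[OF T, of "1/2"] order_tendstoD[OF T, of 2]
    by (simp add: eventually_conj)
  then obtain K1 where K1: "\<And>h. h \<ge> K1 \<Longrightarrow> 1/2 < q h \<and> q h < 2"
    by (auto simp: eventually_at_top_linorder)
  have "\<forall>\<^sub>F h in at_bot. 1/2 < q h \<and> q h < 2"
    using order_tendstoD[OF B, of "1/2"] order_tendstoD[OF B, of 2]
    by (simp add: eventually_conj)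
  then obtain K2 where K2: "\<And>h. h \<le> K2 \<Longrightarrow> 1/2 < q h \<and> q h < 2"
    by (auto simp: eventually_at_bot_linorder)
  \<comment> \<open>Outside \<open>J\<close> the limits confine \<open>q\<close> to values between
    \<open>1/2\<close> and \<open>2\<close>. The order of \<open>K1\<close> and \<open>K2\<close> is
    unknown; sorting them keeps \<open>J\<close> nonempty for the extreme value theorem.\<close>
  define J where "J = {min K1 K2..max K1 K2}"
  have J: "compact J" "J \<noteq> {}" "continuous_on J q"
    using \<open>continuous_on UNIV q\<close> by (auto simp: J_def intro: continuous_on_subset)
  obtain x1 where x1: "\<And>y. y \<in> J \<Longrightarrow> q x1 \<le> q y"
    using continuous_attains_inf[OF J] by blast
  obtain x2 where x2: "\<And>y. y \<in> J \<Longrightarrow> q y \<le> q x2"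
    using continuous_attains_sup[OF J] by blast
  have lo: "min (1/2) (q x1) \<le> q h" and hi: "q h \<le> max 2 (q x2)" for h
  proof -
    have "h \<in> J \<or> K1 \<le> h \<or> h \<le> K2"
      by (auto simp: J_def)
    then show "min (1/2) (q x1) \<le> q h" "q h \<le> max 2 (q x2)"
      using x1[of h] x2[of h] K1[of h] K2[of h] by linarith+
  qed
  have eq: "powr_bregman s 1 h = q h * w h" for h
    using w_pos[of h] by (cases "h = 0") (auto simp: q_def powr_bregman_one w_def)
  have w0: "0 \<le> w h" for h by (simp add: w_def)
  show ?thesis
  proof (rule that)
    show "0 < min (1/2) (q x1)" "0 < max 2 (q x2)"
      using q_pos by auto
    show "min (1/2) (q x1) * (h\<^sup>2 * (1 + \<bar>h\<bar>) powr (s - 2)) \<le> powr_bregman s 1 h" for h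
      using mult_right_mono[OF lo w0[of h]] unfolding eq by (simp only: w_def)
    show "powr_bregman s 1 h \<le> max 2 (q x2) * (h\<^sup>2 * (1 + \<bar>h\<bar>) powr (s - 2))" for h
      using mult_right_mono[OF hi w0[of h]] unfolding eq by (simp only: w_def)
  qed
qed

text \<open>Homogeneity of degree \<open>s\<close> moves every nonzero base point to
  \<open>1\<close>; a negative \<open>t\<close> only flips the sign of \<open>h / t\<close>.\<close>

lemma powr_bregman_scale:
  assumes t: "t \<noteq> 0"
  shows "powr_bregman s t h = \<bar>t\<bar> powr s * powr_bregman s 1 (h / t)"
proof -
  have "\<bar>t\<bar> powr s * \<bar>1 + h / t\<bar> powr s = \<bar>t + h\<bar> powr s"
    using t by (simp flip: powr_mult abs_mult add: distrib_left)
  moreover have "\<bar>t\<bar> powr s = \<bar>t\<bar> powr (s - 2) * t\<^sup>2"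
    using t by (simp add: powr_diff)
  then have "\<bar>t\<bar> powr s * (h / t) = \<bar>t\<bar> powr (s - 2) * t * h"
    using t by (simp add: power2_eq_square)
  then have "\<bar>t\<bar> powr s * (s * (h / t)) = s * (\<bar>t\<bar> powr (s - 2) * t) * h"
    by (simp only: mult.assoc mult.left_commute)
  ultimately show ?thesis
    unfolding powr_bregman_one by (simp add: powr_bregman_def right_diff_distrib)
qed

lemma powr_bregman_nonneg:
  assumes s: "1 < s"
  shows "0 \<le> powr_bregman s t h"
proof (cases "t = 0")
  case True
  then show ?thesis by (simp add: powr_bregman_def)
next
  case False
  have "0 \<le> powr_bregman s 1 (h / t)"
    using powr_bregman_one_pos[OF s, of "h / t"]
    by (cases "h / t = 0") (auto simp: powr_bregman_one)
  then show ?thesis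
    unfolding powr_bregman_scale[OF False] by simp
qed

lemma powr_bregman_bounds:
  assumes s: "1 < s"
  obtains c C where "0 < c" "0 < C"
    "\<And>t h. c * (h\<^sup>2 * (\<bar>t\<bar> + \<bar>h\<bar>) powr (s - 2)) \<le> powr_bregman s t h"
    "\<And>t h. powr_bregman s t h \<le> C * (h\<^sup>2 * (\<bar>t\<bar> + \<bar>h\<bar>) powr (s - 2))"
proof -
  obtain c C where c: "0 < c" and C: "0 < C"
    and lo: "\<And>h. c * (h\<^sup>2 * (1 + \<bar>h\<bar>) powr (s - 2)) \<le> powr_bregman s 1 h"
    and hi: "\<And>h. powr_bregman s 1 h \<le> C * (h\<^sup>2 * (1 + \<bar>h\<bar>) powr (s - 2))"
    using powr_bregman_one_bounds[OF s] by blast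
  have zero: "powr_bregman s 0 h = h\<^sup>2 * \<bar>h\<bar> powr (s - 2)" for h
    by (cases "h = 0") (auto simp: powr_bregman_def powr_diff)
  have scale: "\<bar>t\<bar> powr s * ((h / t)\<^sup>2 * (1 + \<bar>h / t\<bar>) powr (s - 2)) = h\<^sup>2 * (\<bar>t\<bar> + \<bar>h\<bar>) powr (s - 2)"
    if t: "t \<noteq> 0" for t h
  proof -
    have "\<bar>t\<bar> powr s = \<bar>t\<bar> powr (s - 2) * t\<^sup>2"
      using t by (simp add: powr_diff)
    moreover have "\<bar>t\<bar> powr (s - 2) * (1 + \<bar>h / t\<bar>) powr (s - 2) = (\<bar>t\<bar> + \<bar>h\<bar>) powr (s - 2)"
      using t by (simp flip: powr_mult add: distrib_left)
    ultimately show ?thesis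
      using t by (simp add: power_divide)
  qed
  show ?thesis
  \<comment> \<open>The \<open>1\<close> serves the base point \<open>t = 0\<close>, where the
    distance equals the comparison term exactly.\<close>
  proof (rule that[of "min c 1" "max C 1"])
    fix t h :: real
    define W where "W = h\<^sup>2 * (\<bar>t\<bar> + \<bar>h\<bar>) powr (s - 2)"
    have W: "0 \<le> W" by (simp add: W_def)
    show "min c 1 * (h\<^sup>2 * (\<bar>t\<bar> + \<bar>h\<bar>) powr (s - 2)) \<le> powr_bregman s t h"
    proof (cases "t = 0")
      case True
      have "min c 1 * W \<le> 1 * W" by (rule mult_right_mono[OF _ W]) simp
      with True show ?thesis by (simp add: zero W_def)
    next
      case False
      have "min c 1 * W \<le> c * W" by (rule mult_right_mono[OF _ W]) simp
      also have "c * W \<le> powr_bregman s t h"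
        using mult_left_mono[OF lo[of "h / t"], of "\<bar>t\<bar> powr s"]
        unfolding mult.left_commute[of "\<bar>t\<bar> powr s" c] scale[OF False]
          powr_bregman_scale[OF False, symmetric] W_def by simp
      finally show ?thesis by (simp add: W_def)
    qed
    show "powr_bregman s t h \<le> max C 1 * (h\<^sup>2 * (\<bar>t\<bar> + \<bar>h\<bar>) powr (s - 2))"
    proof (cases "t = 0")
      case True
      have "1 * W \<le> max C 1 * W" by (rule mult_right_mono[OF _ W]) simp
      with True show ?thesis by (simp add: zero W_def)
    next
      case False
      have "powr_bregman s t h \<le> C * W"
        using mult_left_mono[OF hi[of "h / t"], of "\<bar>t\<bar> powr s"]
        unfolding mult.left_commute[of "\<bar>t\<bar> powr s" C] scale[OF False]
          powr_bregman_scale[OF False, symmetric] W_def by simp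
      also have "C * W \<le> max C 1 * W" by (rule mult_right_mono[OF _ W]) simp
      finally show ?thesis by (simp add: W_def)
    qed
  qed (use c C in auto)
qed

section \<open>Sums of scalar distances against powers of the norm\<close>

lemma powr_eq_square_mult: "0 \<le> b \<Longrightarrow> b powr s = b\<^sup>2 * b powr (s - 2)" for b :: real
  by (cases "b = 0") (auto simp: powr_diff)

lemma powr_add_le:
  fixes a b :: real
  assumes "0 \<le> a" "0 \<le> b" "0 \<le> s"
  shows "(a + b) powr s \<le> 2 powr s * (a powr s + b powr s)"
proof -
  have "(a + b) powr s \<le> (2 * max a b) powr s"
    using assms by (intro powr_mono2) auto
  also have "\<dots> = 2 powr s * max a b powr s"
    using assms by (simp add: powr_mult)
  also have "\<dots> \<le> 2 powr s * (a powr s + b powr s)"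
    using assms by (intro mult_left_mono) (auto simp: max_def)
  finally show ?thesis .
qed

lemma sum_powr_add_le:
  fixes u v :: "'a \<Rightarrow> real"
  assumes "0 \<le> s"
  shows "(\<Sum>i\<in>I. (\<bar>u i\<bar> + \<bar>v i\<bar>) powr s)
    \<le> 2 powr s * ((\<Sum>i\<in>I. \<bar>u i\<bar> powr s) + (\<Sum>i\<in>I. \<bar>v i\<bar> powr s))"
  using assms
  by (auto simp: sum_distrib_left distrib_left simp flip: sum.distrib
      intro!: sum_mono order_trans[OF powr_add_le])

text \<open>As \<open>s - 2 \<ge> 0\<close>, shrinking the weight to
  \<open>\<bar>v i\<bar> powr (s - 2)\<close> gives the lower bound termwise. For the upper bound
  \<open>v\<close> is divided by \<open>V\<close>, and a Young-type inequality separates the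
  normalized vector from the weight.\<close>

lemma energy_bounds_ge_2:
  fixes u v :: "'a \<Rightarrow> real"
  assumes s: "2 \<le> s" and V: "0 \<le> V" and v: "(\<Sum>i\<in>I. \<bar>v i\<bar> powr s) = V powr s"
    and K: "(\<Sum>i\<in>I. (\<bar>u i\<bar> + \<bar>v i\<bar>) powr s) \<le> K" and I: "finite I"
  shows "V powr s \<le> (\<Sum>i\<in>I. (v i)\<^sup>2 * (\<bar>u i\<bar> + \<bar>v i\<bar>) powr (s - 2))"
    and "(\<Sum>i\<in>I. (v i)\<^sup>2 * (\<bar>u i\<bar> + \<bar>v i\<bar>) powr (s - 2)) \<le> (1 + K) * V\<^sup>2"
proof -
  show "V powr s \<le> (\<Sum>i\<in>I. (v i)\<^sup>2 * (\<bar>u i\<bar> + \<bar>v i\<bar>) powr (s - 2))"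
    unfolding v[symmetric]
  proof (rule sum_mono)
    fix i
    have "\<bar>v i\<bar> powr s = (v i)\<^sup>2 * \<bar>v i\<bar> powr (s - 2)"
      using powr_eq_square_mult[of "\<bar>v i\<bar>" s] by simp
    also have "\<dots> \<le> (v i)\<^sup>2 * (\<bar>u i\<bar> + \<bar>v i\<bar>) powr (s - 2)"
      using s by (intro mult_left_mono powr_mono2) auto
    finally show "\<bar>v i\<bar> powr s \<le> (v i)\<^sup>2 * (\<bar>u i\<bar> + \<bar>v i\<bar>) powr (s - 2)" .
  qed
  show "(\<Sum>i\<in>I. (v i)\<^sup>2 * (\<bar>u i\<bar> + \<bar>v i\<bar>) powr (s - 2)) \<le> (1 + K) * V\<^sup>2"
  proof (cases "V = 0")
    case True
    then have "\<forall>i\<in>I. v i = 0"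
      using v s I by (simp add: sum_nonneg_eq_0_iff)
    then show ?thesis using True by simp
  next
    case False
    \<comment> \<open>Replacing both arguments by the larger one costs only a constant, so the sharp
      form of Young's inequality is avoided.\<close>
    have Young: "b\<^sup>2 * w powr (s - 2) \<le> b powr s + w powr s" if "0 \<le> b" "0 \<le> w" for b w :: real
    proof -
      have "b\<^sup>2 * w powr (s - 2) \<le> (max b w)\<^sup>2 * max b w powr (s - 2)"
        using that s by (intro mult_mono powr_mono2 power_mono) auto
      also have "\<dots> = max b w powr s"
        using that by (simp add: powr_eq_square_mult[of _ s])
      also have "\<dots> \<le> b powr s + w powr s"
        by (simp add: max_def)
      finally show ?thesis .
    qed
    have "(\<Sum>i\<in>I. (v i)\<^sup>2 * (\<bar>u i\<bar> + \<bar>v i\<bar>) powr (s - 2))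
      \<le> (\<Sum>i\<in>I. V\<^sup>2 * (\<bar>v i\<bar> powr s / V powr s + (\<bar>u i\<bar> + \<bar>v i\<bar>) powr s))"
    proof (rule sum_mono)
      fix i
      have "(v i)\<^sup>2 * (\<bar>u i\<bar> + \<bar>v i\<bar>) powr (s - 2)
        = V\<^sup>2 * ((\<bar>v i\<bar> / V)\<^sup>2 * (\<bar>u i\<bar> + \<bar>v i\<bar>) powr (s - 2))"
        using False by (simp add: power_divide)
      also have "\<dots> \<le> V\<^sup>2 * ((\<bar>v i\<bar> / V) powr s + (\<bar>u i\<bar> + \<bar>v i\<bar>) powr s)"
        using V by (intro mult_left_mono Young) auto
      finally show "(v i)\<^sup>2 * (\<bar>u i\<bar> + \<bar>v i\<bar>) powr (s - 2)
          \<le> V\<^sup>2 * (\<bar>v i\<bar> powr s / V powr s + (\<bar>u i\<bar> + \<bar>v i\<bar>) powr s)"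
        using V by (simp add: powr_divide)
    qed
    also have "\<dots> = V\<^sup>2 * (1 + (\<Sum>i\<in>I. (\<bar>u i\<bar> + \<bar>v i\<bar>) powr s))"
      using v False by (simp add: sum.distrib flip: sum_distrib_left sum_divide_distrib)
    also have "\<dots> \<le> V\<^sup>2 * (1 + K)"
      using K by (intro mult_left_mono) auto
    finally show ?thesis by (simp add: mult.commute)
  qed
qed

text \<open>Where \<open>\<bar>v\<bar>\<close> is small against \<open>w\<close>, the energy term
  alone is too weak, and \<open>w powr s\<close> takes over. Otherwise
  \<open>w < \<bar>v\<bar> / e\<close>, and the nonpositive exponent \<open>s - 2\<close> turns this
  into a lower bound for the energy. The threshold \<open>e\<close> stays free for later
  tuning.\<close>

lemma powr_le_energy_split:
  fixes v w e :: real
  assumes s: "1 < s" "s \<le> 2" and e: "0 < e" and w: "\<bar>v\<bar> \<le> w"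
  shows "\<bar>v\<bar> powr s \<le> e powr s * w powr s + e powr (s - 2) * (v\<^sup>2 * w powr (s - 2))"
proof (cases "\<bar>v\<bar> \<le> e * w")
  case True
  have "\<bar>v\<bar> powr s \<le> (e * w) powr s"
    using True s by (intro powr_mono2) auto
  also have "\<dots> = e powr s * w powr s"
    using e w by (simp add: powr_mult)
  also have "\<dots> \<le> \<dots> + e powr (s - 2) * (v\<^sup>2 * w powr (s - 2))"
    by simp
  finally show ?thesis .
next
  case False
  have "0 < w"
    using False w by (cases "w = 0") auto
  have "(\<bar>v\<bar> / e) powr (s - 2) \<le> w powr (s - 2)"
    using False e s \<open>0 < w\<close> by (intro powr_mono2') (auto simp: field_simps)
  then have "e powr (s - 2) * (v\<^sup>2 * (\<bar>v\<bar> / e) powr (s - 2)) \<le> e powr (s - 2) * (v\<^sup>2 * w powr (s - 2))"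
    by (intro mult_left_mono) auto
  moreover have "e powr (s - 2) * (v\<^sup>2 * (\<bar>v\<bar> / e) powr (s - 2)) = \<bar>v\<bar> powr s"
    using powr_eq_square_mult[of "\<bar>v\<bar>" s] e by (simp add: powr_divide)
  ultimately show ?thesis
    by (smt (verit) powr_ge_zero mult_nonneg_nonneg)
qed

text \<open>Now \<open>s - 2 \<le> 0\<close>, so the termwise comparison gives the upper bound
  instead. The lower bound sums \<open>powr_le_energy_split\<close> with a threshold proportional to
  \<open>V\<close>; after absorption a factor \<open>V powr (s - 2)\<close> cancels and
  \<open>V\<^sup>2\<close> remains.\<close>

lemma energy_bounds_le_2:
  fixes u v :: "'a \<Rightarrow> real"
  assumes s: "1 < s" "s \<le> 2" and V: "0 \<le> V" and v: "(\<Sum>i\<in>I. \<bar>v i\<bar> powr s) = V powr s"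
    and K: "(\<Sum>i\<in>I. (\<bar>u i\<bar> + \<bar>v i\<bar>) powr s) \<le> K" "0 < K"
  shows "V\<^sup>2 \<le> 2 * ((1 / (2 * K)) powr (1 / s)) powr (s - 2) *
      (\<Sum>i\<in>I. (v i)\<^sup>2 * (\<bar>u i\<bar> + \<bar>v i\<bar>) powr (s - 2))"
    and "(\<Sum>i\<in>I. (v i)\<^sup>2 * (\<bar>u i\<bar> + \<bar>v i\<bar>) powr (s - 2)) \<le> V powr s"
proof -
  define E where "E = (\<Sum>i\<in>I. (v i)\<^sup>2 * (\<bar>u i\<bar> + \<bar>v i\<bar>) powr (s - 2))"
  have "E \<le> V powr s"
    unfolding v[symmetric] E_def
  proof (rule sum_mono)
    fix i
    have "(v i)\<^sup>2 * (\<bar>u i\<bar> + \<bar>v i\<bar>) powr (s - 2) \<le> (v i)\<^sup>2 * \<bar>v i\<bar> powr (s - 2)"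
    proof (cases "v i = 0")
      case False
      then show ?thesis
        using s by (intro mult_left_mono powr_mono2') auto
    qed simp
    also have "\<dots> = \<bar>v i\<bar> powr s"
      using powr_eq_square_mult[of "\<bar>v i\<bar>" s] by simp
    finally show "(v i)\<^sup>2 * (\<bar>u i\<bar> + \<bar>v i\<bar>) powr (s - 2) \<le> \<bar>v i\<bar> powr s" .
  qed
  then show "(\<Sum>i\<in>I. (v i)\<^sup>2 * (\<bar>u i\<bar> + \<bar>v i\<bar>) powr (s - 2)) \<le> V powr s"
    by (simp add: E_def)
  define d where "d = (1 / (2 * K)) powr (1 / s)"
  have d: "0 < d" "d powr s * K = 1 / 2"
    using K s by (auto simp: d_def powr_powr)
  have E0: "0 \<le> E"
    by (simp add: E_def sum_nonneg)
  have "V\<^sup>2 \<le> 2 * d powr (s - 2) * E"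
  proof (cases "V = 0")
    case True
    then show ?thesis using E0 by simp
  next
    case False
    \<comment> \<open>\<open>d\<close> is chosen so that the first part of the splitting absorbs half of \<open>V powr s\<close>.\<close>
    have "V powr s \<le> (\<Sum>i\<in>I. (d * V) powr s * (\<bar>u i\<bar> + \<bar>v i\<bar>) powr s
        + (d * V) powr (s - 2) * ((v i)\<^sup>2 * (\<bar>u i\<bar> + \<bar>v i\<bar>) powr (s - 2)))"
      unfolding v[symmetric] using s d V False by (intro sum_mono powr_le_energy_split) auto
    also have "\<dots> = (d * V) powr s * (\<Sum>i\<in>I. (\<bar>u i\<bar> + \<bar>v i\<bar>) powr s) + (d * V) powr (s - 2) * E"
      by (simp add: E_def sum.distrib sum_distrib_left)
    also have "\<dots> \<le> (d * V) powr s * K + (d * V) powr (s - 2) * E"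
      using K by (intro add_right_mono mult_left_mono) auto
    also have "(d * V) powr s * K = V powr s / 2"
    proof -
      have "(d * V) powr s * K = V powr s * (d powr s * K)"
        using d V by (simp add: powr_mult)
      then show ?thesis by (simp only: d)
    qed
    finally have "V powr s \<le> 2 * (d * V) powr (s - 2) * E"
      by simp
    also have "\<dots> = V powr (s - 2) * (2 * d powr (s - 2) * E)"
      using d V by (simp add: powr_mult)
    finally have "V powr (s - 2) * V\<^sup>2 \<le> V powr (s - 2) * (2 * d powr (s - 2) * E)"
      using powr_eq_square_mult[OF V, of s] by (simp add: mult.commute)
    then show ?thesis
      using False V by simp
  qed
  then show "V\<^sup>2 \<le> 2 * ((1 / (2 * K)) powr (1 / s)) powr (s - 2) *
      (\<Sum>i\<in>I. (v i)\<^sup>2 * (\<bar>u i\<bar> + \<bar>v i\<bar>) powr (s - 2))"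
    by (simp add: E_def d_def)
qed

text \<open>This is the case \<open>p = s\<close> for a base vector of norm one and bounded
  increments. The constants are chosen before the index set, hence do not depend on the
  dimension.\<close>

lemma sum_powr_bregman_bounds:
  assumes s: "1 < s" and R: "0 \<le> R"
  obtains c C where "0 < c" "0 < C"
    "\<And>(I :: 'a set) u v V. \<lbrakk>finite I; (\<Sum>i\<in>I. \<bar>u i\<bar> powr s) = 1; (\<Sum>i\<in>I. \<bar>v i\<bar> powr s) = V powr s;
        0 \<le> V; V \<le> R\<rbrakk> \<Longrightarrow> c * V powr max s 2 \<le> (\<Sum>i\<in>I. powr_bregman s (u i) (v i))"
    "\<And>(I :: 'a set) u v V. \<lbrakk>finite I; (\<Sum>i\<in>I. \<bar>u i\<bar> powr s) = 1; (\<Sum>i\<in>I. \<bar>v i\<bar> powr s) = V powr s;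
        0 \<le> V; V \<le> R\<rbrakk> \<Longrightarrow> (\<Sum>i\<in>I. powr_bregman s (u i) (v i)) \<le> C * V powr min s 2"
proof -
  obtain c C where c: "0 < c" and C: "0 < C"
    and lo: "\<And>t h. c * (h\<^sup>2 * (\<bar>t\<bar> + \<bar>h\<bar>) powr (s - 2)) \<le> powr_bregman s t h"
    and hi: "\<And>t h. powr_bregman s t h \<le> C * (h\<^sup>2 * (\<bar>t\<bar> + \<bar>h\<bar>) powr (s - 2))"
    using powr_bregman_bounds[OF s] by blast
  \<comment> \<open>\<open>K\<close> bounds the sum of
    \<open>(\<bar>u i\<bar> + \<bar>v i\<bar>) powr s\<close> when \<open>V \<le> R\<close>, and
    \<open>k\<close> is the resulting constant for \<open>s \<le> 2\<close>; \<open>max 1 k\<close>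
    then covers both ranges of \<open>s\<close>.\<close>
  define K where "K = 2 powr s * (1 + R powr s)"
  have K: "0 < K" by (simp add: K_def add_pos_nonneg)
  define k where "k = 2 * ((1 / (2 * K)) powr (1 / s)) powr (s - 2)"
  have k: "0 < k" using K by (simp add: k_def)
  have main: "c / max 1 k * V powr max s 2 \<le> (\<Sum>i\<in>I. powr_bregman s (u i) (v i)) \<and>
      (\<Sum>i\<in>I. powr_bregman s (u i) (v i)) \<le> C * (1 + K) * V powr min s 2"
    if I: "finite I" and u: "(\<Sum>i\<in>I. \<bar>u i\<bar> powr s) = 1" and v: "(\<Sum>i\<in>I. \<bar>v i\<bar> powr s) = V powr s"
      and V: "0 \<le> V" "V \<le> R" for I :: "'a set" and u v V
  proof -
    define E where "E = (\<Sum>i\<in>I. (v i)\<^sup>2 * (\<bar>u i\<bar> + \<bar>v i\<bar>) powr (s - 2))"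
    have cE: "c * E \<le> (\<Sum>i\<in>I. powr_bregman s (u i) (v i))"
      unfolding E_def sum_distrib_left by (intro sum_mono lo)
    have EC: "(\<Sum>i\<in>I. powr_bregman s (u i) (v i)) \<le> C * E"
      unfolding E_def sum_distrib_left by (intro sum_mono hi)
    have "(\<Sum>i\<in>I. (\<bar>u i\<bar> + \<bar>v i\<bar>) powr s) \<le> 2 powr s * (1 + V powr s)"
      using sum_powr_add_le[of s u v I] s by (simp add: u v)
    also have "\<dots> \<le> K"
      unfolding K_def using V s by (intro mult_left_mono add_left_mono powr_mono2) auto
    finally have wK: "(\<Sum>i\<in>I. (\<bar>u i\<bar> + \<bar>v i\<bar>) powr s) \<le> K" .
    have "V powr max s 2 \<le> max 1 k * E \<and> E \<le> (1 + K) * V powr min s 2"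
    proof (cases "2 \<le> s")
      case True
      have V2: "V powr 2 = V\<^sup>2"
        using V by (simp add: powr_numeral)
      have "V powr s \<le> 1 * E" "E \<le> (1 + K) * V\<^sup>2"
        using energy_bounds_ge_2[OF True V(1) v wK I] by (auto simp: E_def)
      moreover have "1 * E \<le> max 1 k * E"
        by (intro mult_right_mono) (auto simp: E_def sum_nonneg)
      ultimately show ?thesis
        using True V2 by (simp add: max_def min_def)
    next
      case False
      then have s2: "s \<le> 2" by simp
      have V2: "V powr 2 = V\<^sup>2"
        using V by (simp add: powr_numeral)
      have "V\<^sup>2 \<le> k * E" "E \<le> V powr s"
        using energy_bounds_le_2[OF s s2 V(1) v wK K] by (auto simp: E_def k_def)
      moreover have "k * E \<le> max 1 k * E"
        by (intro mult_right_mono) (auto simp: E_def sum_nonneg)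
      moreover have "1 * V powr s \<le> (1 + K) * V powr s"
        using K by (intro mult_right_mono) auto
      ultimately show ?thesis
        using False V2 by (simp add: max_def[of s] min_def)
    qed
    then have a: "V powr max s 2 \<le> max 1 k * E" and b: "E \<le> (1 + K) * V powr min s 2"
      by auto
    have "c * V powr max s 2 \<le> c * (max 1 k * E)"
      using a c by (intro mult_left_mono) auto
    then have "c / max 1 k * V powr max s 2 \<le> c * E"
      using k by (simp add: field_simps max_def split: if_splits)
    moreover have "C * E \<le> C * ((1 + K) * V powr min s 2)"
      using b C by (intro mult_left_mono) auto
    ultimately show ?thesis
      using cE EC by (simp add: mult.assoc)
  qed
  show ?thesis
    by (rule that[of "c / max 1 k" "C * (1 + K)"]) (use main c C K k in auto)
qed

section \<open>Finite \<open>\<ell>\<^sup>s\<close> norms and duality\<close>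

definition lp_norm :: "real \<Rightarrow> 'a set \<Rightarrow> ('a \<Rightarrow> real) \<Rightarrow> real" where
  "lp_norm s I x = (\<Sum>i\<in>I. \<bar>x i\<bar> powr s) powr (1 / s)"

text \<open>The derivative at \<open>x\<close> of the sum of
  \<open>\<bar>x i\<bar> powr s / s\<close>, applied to \<open>y\<close>. For \<open>x\<close> of
  norm one it is the norming functional of \<open>x\<close>.\<close>

definition lp_pairing :: "real \<Rightarrow> 'a set \<Rightarrow> ('a \<Rightarrow> real) \<Rightarrow> ('a \<Rightarrow> real) \<Rightarrow> real" where
  "lp_pairing s I x y = (\<Sum>i\<in>I. \<bar>x i\<bar> powr (s - 2) * x i * y i)"

definition lp_bregman :: "real \<Rightarrow> real \<Rightarrow> 'a set \<Rightarrow> ('a \<Rightarrow> real) \<Rightarrow> ('a \<Rightarrow> real) \<Rightarrow> real" where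
  "lp_bregman p s I x y = lp_norm s I (\<lambda>i. x i + y i) powr p - lp_norm s I x powr p
     - p * lp_norm s I x powr (p - s) * lp_pairing s I x y"

lemma lp_norm_nonneg [simp]: "0 \<le> lp_norm s I x"
  by (simp add: lp_norm_def)

lemma lp_norm_powr: "0 < s \<Longrightarrow> lp_norm s I x powr s = (\<Sum>i\<in>I. \<bar>x i\<bar> powr s)"
  by (simp add: lp_norm_def powr_powr sum_nonneg)

lemma lp_norm_eq_0:
  assumes "0 < s" "finite I"
  shows "lp_norm s I x = 0 \<longleftrightarrow> (\<forall>i\<in>I. x i = 0)"
  using assms by (auto simp: lp_norm_def sum_nonneg_eq_0_iff)

lemma lp_norm_scale:
  assumes "0 < s"
  shows "lp_norm s I (\<lambda>i. k * x i) = \<bar>k\<bar> * lp_norm s I x"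
  using assms
  by (simp add: lp_norm_def abs_mult powr_mult powr_powr sum_nonneg flip: sum_distrib_left)

lemma lp_pairing_self: "lp_pairing s I x x = (\<Sum>i\<in>I. \<bar>x i\<bar> powr s)"
  unfolding lp_pairing_def
proof (rule sum.cong[OF refl])
  fix i
  show "\<bar>x i\<bar> powr (s - 2) * x i * x i = \<bar>x i\<bar> powr s"
    using powr_eq_square_mult[of "\<bar>x i\<bar>" s] by (simp add: power2_eq_square mult_ac)
qed

lemma lp_pairing_add: "lp_pairing s I x (\<lambda>i. y i + z i) = lp_pairing s I x y + lp_pairing s I x z"
  by (simp add: lp_pairing_def distrib_left sum.distrib)

lemma lp_pairing_scale_right: "lp_pairing s I x (\<lambda>i. k * y i) = k * lp_pairing s I x y"
  by (simp add: lp_pairing_def sum_distrib_left mult_ac)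

lemma sum_powr_bregman:
  "(\<Sum>i\<in>I. powr_bregman s (u i) (v i))
    = (\<Sum>i\<in>I. \<bar>u i + v i\<bar> powr s) - (\<Sum>i\<in>I. \<bar>u i\<bar> powr s) - s * lp_pairing s I u v"
  by (simp add: powr_bregman_def lp_pairing_def sum_subtractf sum_distrib_left mult_ac)

text \<open>Summing the nonnegative scalar Bregman distances from \<open>u\<close> to \<open>z\<close> divided by its norm
  replaces Young's inequality.\<close>
lemma lp_pairing_le_norm:
  assumes s: "1 < s" and I: "finite I" and u: "lp_norm s I u = 1"
  shows "lp_pairing s I u z \<le> lp_norm s I z"
proof (cases "lp_norm s I z = 0")
  case True
  then show ?thesis
    using s I by (simp add: lp_norm_eq_0 lp_pairing_def)
next
  case False
  define N where "N = lp_norm s I z"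
  have N: "0 < N"
    using False lp_norm_nonneg[of s I z] unfolding N_def by linarith
  have u1: "(\<Sum>i\<in>I. \<bar>u i\<bar> powr s) = 1"
    using lp_norm_powr[of s I u] s u by simp
  have z1: "(\<Sum>i\<in>I. \<bar>z i / N\<bar> powr s) = 1"
  proof -
    have "(\<Sum>i\<in>I. \<bar>z i / N\<bar> powr s) = (\<Sum>i\<in>I. \<bar>z i\<bar> powr s) / N powr s"
      using N by (simp add: powr_divide sum_divide_distrib)
    also have "(\<Sum>i\<in>I. \<bar>z i\<bar> powr s) = N powr s"
      using lp_norm_powr[of s I z] s by (simp add: N_def)
    finally show ?thesis using N by simp
  qed
  have pair: "lp_pairing s I u (\<lambda>i. z i / N - u i) = lp_pairing s I u z / N - 1"
    using lp_pairing_add[of s I u "\<lambda>i. (1 / N) * z i" "\<lambda>i. - 1 * u i"]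
    unfolding lp_pairing_scale_right lp_pairing_self u1 by simp
  have "0 \<le> (\<Sum>i\<in>I. powr_bregman s (u i) (z i / N - u i))"
    by (intro sum_nonneg powr_bregman_nonneg s)
  \<comment> \<open>Both vectors have norm one, so the two power sums cancel and only the linear
    term survives.\<close>
  also have "\<dots> = - s * (lp_pairing s I u z / N - 1)"
    using z1 by (simp add: sum_powr_bregman pair u1)
  finally have "lp_pairing s I u z / N \<le> 1"
    using s by (simp add: mult_le_0_iff)
  then show ?thesis
    using N by (simp add: N_def)
qed

text \<open>The norm of the sum is its pairing with the norming functional of its own normalization
  \<open>u\<close>; linearity splits the pairing and duality bounds each part.\<close>

lemma lp_norm_triangle:
  assumes s: "1 < s" and I: "finite I"
  shows "lp_norm s I (\<lambda>i. x i + y i) \<le> lp_norm s I x + lp_norm s I y"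
proof (cases "lp_norm s I (\<lambda>i. x i + y i) = 0")
  case False
  define N where "N = lp_norm s I (\<lambda>i. x i + y i)"
  have N: "0 < N"
    using False lp_norm_nonneg[of s I "\<lambda>i. x i + y i"] unfolding N_def by linarith
  define u where "u = (\<lambda>i. (1 / N) * (x i + y i))"
  have u: "lp_norm s I u = 1"
    unfolding u_def using s N by (subst lp_norm_scale) (auto simp: N_def)
  have "N = N * lp_pairing s I u u"
    using lp_norm_powr[of s I u] s u by (simp add: lp_pairing_self)
  also have "\<dots> = lp_pairing s I u (\<lambda>i. N * u i)"
    by (simp add: lp_pairing_scale_right)
  also have "(\<lambda>i. N * u i) = (\<lambda>i. x i + y i)"
    using N by (simp add: u_def)
  also have "lp_pairing s I u \<dots> \<le> lp_norm s I x + lp_norm s I y"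
    unfolding lp_pairing_add by (intro add_mono lp_pairing_le_norm s I u)
  finally show ?thesis by (simp add: N_def)
qed simp

section \<open>General exponents at a base vector of norm one\<close>

text \<open>The absolute value of the exponent treats both of its signs at once. The interval
  contains \<open>1 + \<bar>h\<bar>\<close> for \<open>\<bar>h\<bar> \<le> 3\<close>, and also
  \<open>1 + 1 / V\<close> for \<open>V \<ge> 3\<close>.\<close>

lemma powr_bounds_1_4:
  fixes x q :: real
  assumes "1 \<le> x" "x \<le> 4"
  shows "x powr q \<le> 4 powr \<bar>q\<bar>" "1 \<le> 4 powr \<bar>q\<bar> * x powr q"
proof -
  have a: "x powr r \<le> 4 powr \<bar>r\<bar>" for r
  proof -
    have "x powr r \<le> x powr \<bar>r\<bar>"
      using assms by (intro powr_mono) auto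
    also have "\<dots> \<le> 4 powr \<bar>r\<bar>"
      using assms by (intro powr_mono2) auto
    finally show ?thesis .
  qed
  then show "x powr q \<le> 4 powr \<bar>q\<bar>" .
  show "1 \<le> 4 powr \<bar>q\<bar> * x powr q"
    using a[of "-q"] assms by (simp add: powr_minus field_simps)
qed

text \<open>On this bounded range the factors \<open>1 + \<bar>h\<bar>\<close> are comparable to
  \<open>1\<close>, so both distances are comparable to \<open>h\<^sup>2\<close>.\<close>

lemma powr_bregman_one_comparison:
  assumes p: "1 < p" and s: "1 < s"
  obtains k where "0 < k"
    "\<And>h. \<bar>h\<bar> \<le> 3 \<Longrightarrow> k * powr_bregman s 1 h \<le> powr_bregman p 1 h"
proof -
  obtain c where c: "0 < c"
    and lo: "\<And>h. c * (h\<^sup>2 * (1 + \<bar>h\<bar>) powr (p - 2)) \<le> powr_bregman p 1 h"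
    using powr_bregman_one_bounds[OF p] by metis
  obtain C where C: "0 < C"
    and hi: "\<And>h. powr_bregman s 1 h \<le> C * (h\<^sup>2 * (1 + \<bar>h\<bar>) powr (s - 2))"
    using powr_bregman_one_bounds[OF s] by metis
  define A B where "A = 4 powr \<bar>s - 2\<bar>" and "B = 4 powr \<bar>p - 2\<bar>"
  have AB: "0 < A" "0 < B" by (auto simp: A_def B_def)
  show ?thesis
  proof (rule that[of "c / (C * A * B)"])
    show "0 < c / (C * A * B)" using c C AB by simp
    fix h :: real
    assume h: "\<bar>h\<bar> \<le> 3"
    have 1: "(1 + \<bar>h\<bar>) powr (s - 2) \<le> A" "1 \<le> B * (1 + \<bar>h\<bar>) powr (p - 2)"
      using h powr_bounds_1_4[of "1 + \<bar>h\<bar>"] by (auto simp: A_def B_def)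
    have "powr_bregman s 1 h \<le> C * (h\<^sup>2 * A)"
      using C by (intro order_trans[OF hi] mult_left_mono 1) auto
    then have "c / (C * A * B) * powr_bregman s 1 h \<le> c / (C * A * B) * (C * (h\<^sup>2 * A))"
      using c C AB by (intro mult_left_mono) auto
    also have "\<dots> = c / B * (h\<^sup>2 * 1)"
      using C AB by simp
    also have "\<dots> \<le> c / B * (h\<^sup>2 * (B * (1 + \<bar>h\<bar>) powr (p - 2)))"
      using c AB by (intro mult_left_mono 1) auto
    also have "\<dots> = c * (h\<^sup>2 * (1 + \<bar>h\<bar>) powr (p - 2))"
      using AB by simp
    also have "\<dots> \<le> powr_bregman p 1 h"
      by (rule lo)
    finally show "c / (C * A * B) * powr_bregman s 1 h \<le> powr_bregman p 1 h" .
  qed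
qed

text \<open>The defect multiplied by \<open>p\<close> does not depend on \<open>p\<close> and is nonnegative by duality.\<close>
lemma lp_bregman_decomposition:
  assumes p: "1 < p" and s: "1 < s" and I: "finite I" and u: "lp_norm s I u = 1"
  shows "lp_bregman p s I u v = powr_bregman p 1 (lp_norm s I (\<lambda>i. u i + v i) - 1)
      + p * (lp_norm s I (\<lambda>i. u i + v i) - 1 - lp_pairing s I u v)"
    and "lp_pairing s I u v \<le> lp_norm s I (\<lambda>i. u i + v i) - 1"
proof -
  show "lp_bregman p s I u v = powr_bregman p 1 (lp_norm s I (\<lambda>i. u i + v i) - 1)
      + p * (lp_norm s I (\<lambda>i. u i + v i) - 1 - lp_pairing s I u v)"
    by (simp add: lp_bregman_def u powr_bregman_one algebra_simps)
  have "lp_pairing s I u u = 1"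
    using lp_norm_powr[of s I u] s u by (simp add: lp_pairing_self)
  then show "lp_pairing s I u v \<le> lp_norm s I (\<lambda>i. u i + v i) - 1"
    using lp_pairing_le_norm[OF s I u, of "\<lambda>i. u i + v i"] by (simp add: lp_pairing_add)
qed

text \<open>In the decomposition the scalar parts compare with constant \<open>k\<close>, and the
  defects are \<open>p\<close> and \<open>q\<close> times the same nonnegative number, which
  explains the ratio \<open>p / q\<close>. Exchanging the exponents gives the reverse
  estimate.\<close>

lemma lp_bregman_comparison:
  assumes p: "1 < p" and q: "1 < q" and s: "1 < s"
  obtains k where "0 < k"
    "\<And>(I :: 'a set) u v. \<lbrakk>finite I; lp_norm s I u = 1; lp_norm s I v \<le> 3\<rbrakk>
      \<Longrightarrow> k * lp_bregman q s I u v \<le> lp_bregman p s I u v"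
proof -
  obtain k where k: "0 < k"
    and kb: "\<And>h. \<bar>h\<bar> \<le> 3 \<Longrightarrow> k * powr_bregman q 1 h \<le> powr_bregman p 1 h"
    using powr_bregman_one_comparison[OF p q] by blast
  show ?thesis
  proof (rule that[of "min k (p / q)"])
    show "0 < min k (p / q)" using k p q by simp
    fix I :: "'a set" and u v
    assume I: "finite I" and u: "lp_norm s I u = 1" and V: "lp_norm s I v \<le> 3"
    define h where "h = lp_norm s I (\<lambda>i. u i + v i) - 1"
    define e where "e = h - lp_pairing s I u v"
    have e: "0 \<le> e"
      using lp_bregman_decomposition(2)[OF p s I u] by (simp add: e_def h_def)
    \<comment> \<open>The norm of \<open>u + v\<close> lies between \<open>0\<close> and
      \<open>1 + 3\<close>, hence \<open>h\<close> lies between \<open>-1\<close> and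
      \<open>3\<close>.\<close>
    have "\<bar>h\<bar> \<le> 3"
      using lp_norm_triangle[OF s I, of u v] u V lp_norm_nonneg[of s I "\<lambda>i. u i + v i"]
      unfolding h_def by linarith
    then have "min k (p / q) * powr_bregman q 1 h \<le> powr_bregman p 1 h"
      using kb[of h] powr_bregman_nonneg[OF q, of 1 h]
      by (meson min.cobounded1 mult_right_mono order_trans)
    moreover have "min k (p / q) * (q * e) \<le> p / q * (q * e)"
      using e q by (intro mult_right_mono) auto
    ultimately show "min k (p / q) * lp_bregman q s I u v \<le> lp_bregman p s I u v"
      unfolding lp_bregman_decomposition(1)[OF p s I u] lp_bregman_decomposition(1)[OF q s I u]
      using q by (simp add: e_def h_def distrib_left)
  qed
qed

text \<open>For \<open>p = s\<close> the factor \<open>lp_norm s I u powr (p - s)\<close> is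
  \<open>1\<close>, so the distance is the sum of scalar ones estimated above. Comparing
  \<open>p\<close> with \<open>s\<close> in both directions transfers the two bounds.\<close>

lemma lp_bregman_bounds_small:
  assumes p: "1 < p" and s: "1 < s"
  obtains c C where "0 < c" "0 < C"
    "\<And>(I :: 'a set) u v. \<lbrakk>finite I; lp_norm s I u = 1; lp_norm s I v \<le> 3\<rbrakk>
      \<Longrightarrow> c * lp_norm s I v powr max s 2 \<le> lp_bregman p s I u v"
    "\<And>(I :: 'a set) u v. \<lbrakk>finite I; lp_norm s I u = 1; lp_norm s I v \<le> 3\<rbrakk>
      \<Longrightarrow> lp_bregman p s I u v \<le> C * lp_norm s I v powr min s 2"
proof -
  obtain c C where c: "0 < c" and C: "0 < C" and
    lo: "\<And>(I :: 'a set) u v V. \<lbrakk>finite I; (\<Sum>i\<in>I. \<bar>u i\<bar> powr s) = 1; (\<Sum>i\<in>I. \<bar>v i\<bar> powr s) = V powr s;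
        0 \<le> V; V \<le> 3\<rbrakk> \<Longrightarrow> c * V powr max s 2 \<le> (\<Sum>i\<in>I. powr_bregman s (u i) (v i))" and
    hi: "\<And>(I :: 'a set) u v V. \<lbrakk>finite I; (\<Sum>i\<in>I. \<bar>u i\<bar> powr s) = 1; (\<Sum>i\<in>I. \<bar>v i\<bar> powr s) = V powr s;
        0 \<le> V; V \<le> 3\<rbrakk> \<Longrightarrow> (\<Sum>i\<in>I. powr_bregman s (u i) (v i)) \<le> C * V powr min s 2"
    using sum_powr_bregman_bounds[OF s zero_le_numeral[of "num.Bit1 num.One"]] by blast
  have eq: "(\<Sum>i\<in>I. powr_bregman s (u i) (v i)) = lp_bregman s s I u v"
    if "lp_norm s I u = 1" for I :: "'a set" and u v
    using s that by (simp add: sum_powr_bregman lp_bregman_def flip: lp_norm_powr)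
  have n1: "(\<Sum>i\<in>I. \<bar>u i\<bar> powr s) = 1" if "lp_norm s I u = 1" for I :: "'a set" and u
    using s that lp_norm_powr[of s I u] by simp
  have nV: "(\<Sum>i\<in>I. \<bar>v i\<bar> powr s) = lp_norm s I v powr s" for I :: "'a set" and v
    using s lp_norm_powr[of s I v] by simp
  obtain k where k: "0 < k" and kp: "\<And>(I :: 'a set) u v. \<lbrakk>finite I; lp_norm s I u = 1; lp_norm s I v \<le> 3\<rbrakk>
      \<Longrightarrow> k * lp_bregman s s I u v \<le> lp_bregman p s I u v"
    using lp_bregman_comparison[OF p s s] by metis
  obtain l where l: "0 < l" and lp: "\<And>(I :: 'a set) u v. \<lbrakk>finite I; lp_norm s I u = 1; lp_norm s I v \<le> 3\<rbrakk>
      \<Longrightarrow> l * lp_bregman p s I u v \<le> lp_bregman s s I u v"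
    using lp_bregman_comparison[OF s p s] by metis
  show ?thesis
  proof (rule that[of "k * c" "C / l"])
    show "0 < k * c" "0 < C / l" using k c l C by auto
    fix I :: "'a set" and u v
    assume I: "finite I" and u: "lp_norm s I u = 1" and V: "lp_norm s I v \<le> 3"
    have "k * (c * lp_norm s I v powr max s 2) \<le> k * lp_bregman s s I u v"
      using lo[OF I n1[OF u] nV lp_norm_nonneg V] eq[OF u] k by simp
    then show "k * c * lp_norm s I v powr max s 2 \<le> lp_bregman p s I u v"
      using kp[OF I u V] by simp
    show "lp_bregman p s I u v \<le> C / l * lp_norm s I v powr min s 2"
      using order_trans[OF lp[OF I u V]] hi[OF I n1[OF u] nV lp_norm_nonneg V] eq[OF u] l
      by (simp add: field_simps)
  qed
qed

text \<open>For the lower bound the nonnegative defect is dropped and the scalar part is of order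
  \<open>r powr p\<close>. For the upper bound duality controls the pairing by \<open>V\<close>,
  which is at most \<open>V powr p\<close>.\<close>

lemma lp_bregman_bounds_large:
  assumes p: "1 < p" and s: "1 < s"
  obtains c C where "0 < c" "0 < C"
    "\<And>(I :: 'a set) u v. \<lbrakk>finite I; lp_norm s I u = 1; 3 \<le> lp_norm s I v\<rbrakk>
      \<Longrightarrow> c * lp_norm s I v powr p \<le> lp_bregman p s I u v"
    "\<And>(I :: 'a set) u v. \<lbrakk>finite I; lp_norm s I u = 1; 3 \<le> lp_norm s I v\<rbrakk>
      \<Longrightarrow> lp_bregman p s I u v \<le> C * lp_norm s I v powr p"
proof -
  obtain c where c: "0 < c"
    and lo: "\<And>h. c * (h\<^sup>2 * (1 + \<bar>h\<bar>) powr (p - 2)) \<le> powr_bregman p 1 h"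
    using powr_bregman_one_bounds[OF p] by metis
  show ?thesis
  proof (rule that[of "c / 4 * (1 / 2) powr p" "2 powr p + p"])
    show "0 < c / 4 * (1 / 2) powr p" "0 < 2 powr p + p"
      using c p by (auto intro: add_pos_pos)
    fix I :: "'a set" and u v
    assume I: "finite I" and u: "lp_norm s I u = 1" and V3: "3 \<le> lp_norm s I v"
    define V where "V = lp_norm s I v"
    define r where "r = lp_norm s I (\<lambda>i. u i + v i)"
    have V: "3 \<le> V" using V3 by (simp add: V_def)
    have neg: "lp_norm s I (\<lambda>i. - x i) = lp_norm s I x" for x
      by (simp add: lp_norm_def)
    have rV: "r \<le> 2 * V"
      using lp_norm_triangle[OF s I, of u v] u V by (simp add: r_def V_def)
    have Vr: "V \<le> r + 1"
      using lp_norm_triangle[OF s I, of "\<lambda>i. u i + v i" "\<lambda>i. - u i"] u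
      by (simp add: r_def V_def neg)
    \<comment> \<open>\<open>r \<ge> V - 1\<close> and \<open>V \<ge> 3\<close> give
      \<open>V / 2 \<le> r\<close>.\<close>
    have "(1 / 2 * V) powr p \<le> r powr p"
      using V Vr p by (intro powr_mono2) auto
    then have "(1 / 2) powr p * V powr p \<le> r powr p"
      using V by (simp only: powr_mult)
    then have "c / 4 * ((1 / 2) powr p * V powr p) \<le> c / 4 * r powr p"
      using c by (intro mult_left_mono) auto
    also have "\<dots> = c * ((r / 2)\<^sup>2 * r powr (p - 2))"
      using V Vr by (simp add: powr_eq_square_mult[of r p] power_divide)
    \<comment> \<open>Here \<open>r \<ge> 2\<close>, so \<open>r / 2 \<le> r - 1\<close> and
      \<open>1 + \<bar>r - 1\<bar> = r\<close>; this is the source of the factor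
      \<open>1 / 4\<close>.\<close>
    also have "\<dots> \<le> c * ((r - 1)\<^sup>2 * (1 + \<bar>r - 1\<bar>) powr (p - 2))"
      using V Vr c by (intro mult_left_mono mult_mono power_mono) auto
    also have "\<dots> \<le> powr_bregman p 1 (r - 1)"
      by (rule lo)
    also have "\<dots> \<le> lp_bregman p s I u v"
      using lp_bregman_decomposition[OF p s I u, of v] p by (simp add: r_def)
    finally show "c / 4 * (1 / 2) powr p * lp_norm s I v powr p \<le> lp_bregman p s I u v"
      by (simp add: V_def mult.assoc)
    have "- lp_pairing s I u v \<le> V"
      using lp_pairing_le_norm[OF s I u, of "\<lambda>i. - v i"] lp_pairing_scale_right[of s I u "-1" v]
      by (simp add: neg V_def)
    also have "V = V powr 1"
      using V by simp
    also have "\<dots> \<le> V powr p"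
      using V p by (intro powr_mono) auto
    finally have "p * - lp_pairing s I u v \<le> p * V powr p"
      using p by (intro mult_left_mono) auto
    moreover have "r powr p \<le> 2 powr p * V powr p"
    proof -
      have "r powr p \<le> (2 * V) powr p"
        using rV p by (intro powr_mono2) (auto simp: r_def)
      then show ?thesis
        using V by (simp add: powr_mult)
    qed
    ultimately show "lp_bregman p s I u v \<le> (2 powr p + p) * lp_norm s I v powr p"
      by (simp add: lp_bregman_def u r_def V_def distrib_right)
  qed
qed

text \<open>The expression \<open>V powr q * (V + 1) powr (p - q)\<close> is comparable to
  \<open>V powr q\<close> for \<open>V \<le> 3\<close> and to \<open>V powr p\<close> beyond, so it
  joins the bounds for small and large increments.\<close>

lemma lp_bregman_bounds_normalized:
  assumes p: "1 < p" and s: "1 < s"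
  obtains c C where "0 < c" "0 < C"
    "\<And>(I :: 'a set) u v. \<lbrakk>finite I; lp_norm s I u = 1\<rbrakk>
      \<Longrightarrow> c * (lp_norm s I v powr max s 2 * (lp_norm s I v + 1) powr (p - max s 2))
        \<le> lp_bregman p s I u v"
    "\<And>(I :: 'a set) u v. \<lbrakk>finite I; lp_norm s I u = 1\<rbrakk>
      \<Longrightarrow> lp_bregman p s I u v
        \<le> C * (lp_norm s I v powr min s 2 * (lp_norm s I v + 1) powr (p - min s 2))"
proof -
  obtain c1 C1 where 1: "0 < c1" "0 < C1"
    "\<And>(I :: 'a set) u v. \<lbrakk>finite I; lp_norm s I u = 1; lp_norm s I v \<le> 3\<rbrakk>
      \<Longrightarrow> c1 * lp_norm s I v powr max s 2 \<le> lp_bregman p s I u v"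
    "\<And>(I :: 'a set) u v. \<lbrakk>finite I; lp_norm s I u = 1; lp_norm s I v \<le> 3\<rbrakk>
      \<Longrightarrow> lp_bregman p s I u v \<le> C1 * lp_norm s I v powr min s 2"
    using lp_bregman_bounds_small[OF p s] by blast
  obtain c2 C2 where 2: "0 < c2" "0 < C2"
    "\<And>(I :: 'a set) u v. \<lbrakk>finite I; lp_norm s I u = 1; 3 \<le> lp_norm s I v\<rbrakk>
      \<Longrightarrow> c2 * lp_norm s I v powr p \<le> lp_bregman p s I u v"
    "\<And>(I :: 'a set) u v. \<lbrakk>finite I; lp_norm s I u = 1; 3 \<le> lp_norm s I v\<rbrakk>
      \<Longrightarrow> lp_bregman p s I u v \<le> C2 * lp_norm s I v powr p"
    using lp_bregman_bounds_large[OF p s] by blast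
  define A where "A = (\<lambda>q. 4 powr \<bar>p - q\<bar> :: real)"
  have A: "0 < A q" for q by (simp add: A_def)
  \<comment> \<open>\<open>e V q\<close> is the model power of the regime in which \<open>V\<close>
    lies, and \<open>A q\<close> is the cost of replacing it by the joint expression.\<close>
  define e where "e = (\<lambda>V. if V \<le> 3 then (\<lambda>q. V powr q) else (\<lambda>q. V powr p) :: real \<Rightarrow> real)"
  have e: "V powr q * (V + 1) powr (p - q) \<le> A q * e V q"
      "e V q \<le> A q * (V powr q * (V + 1) powr (p - q))" if V: "0 \<le> V" for V q
  proof -
    have "V powr q * (V + 1) powr (p - q) \<le> A q * e V q \<and>
      e V q \<le> A q * (V powr q * (V + 1) powr (p - q))"
    proof (cases "V \<le> 3")
      case True
      have "V powr q * (V + 1) powr (p - q) \<le> V powr q * A q"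
        using V True by (intro mult_left_mono) (auto simp: A_def powr_bounds_1_4)
      moreover have "V powr q * 1 \<le> V powr q * (A q * (V + 1) powr (p - q))"
        unfolding A_def using V True by (intro mult_left_mono powr_bounds_1_4) auto
      ultimately show ?thesis
        using True by (simp add: e_def mult_ac)
    next
      case False
      \<comment> \<open>For large \<open>V\<close> the factor \<open>V\<close> is pulled out of
        \<open>V + 1\<close>, leaving a base between \<open>1\<close> and \<open>4\<close>.\<close>
      have x: "1 \<le> 1 + 1 / V" "1 + 1 / V \<le> 4"
        using False by (auto simp: field_simps)
      have "V + 1 = V * (1 + 1 / V)"
        using False by (simp add: field_simps)
      then have "V powr q * (V + 1) powr (p - q) = V powr q * (V powr (p - q) * (1 + 1 / V) powr (p - q))"
        using False x by (simp only: powr_mult)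
      also have "\<dots> = V powr p * (1 + 1 / V) powr (p - q)"
        using False by (simp add: mult.assoc[symmetric] powr_add[symmetric])
      finally have eq: "V powr q * (V + 1) powr (p - q) = V powr p * (1 + 1 / V) powr (p - q)" .
      have "V powr p * (1 + 1 / V) powr (p - q) \<le> V powr p * A q"
        using x by (intro mult_left_mono) (auto simp: A_def powr_bounds_1_4)
      moreover have "V powr p * 1 \<le> V powr p * (A q * (1 + 1 / V) powr (p - q))"
        unfolding A_def using x by (intro mult_left_mono powr_bounds_1_4) auto
      ultimately show ?thesis
        unfolding eq using False by (simp add: e_def mult_ac)
    qed
    then show "V powr q * (V + 1) powr (p - q) \<le> A q * e V q"
      "e V q \<le> A q * (V powr q * (V + 1) powr (p - q))" by auto
  qed
  have e0: "0 \<le> e V q" for V q by (simp add: e_def)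
  show ?thesis
  proof (rule that[of "min c1 c2 / A (max s 2)" "max C1 C2 * A (min s 2)"])
    show "0 < min c1 c2 / A (max s 2)" "0 < max C1 C2 * A (min s 2)"
      using 1 2 A by auto
    fix I :: "'a set" and u v
    assume I: "finite I" and u: "lp_norm s I u = 1"
    let ?V = "lp_norm s I v"
    have lo: "min c1 c2 * e ?V (max s 2) \<le> lp_bregman p s I u v"
    proof (cases "?V \<le> 3")
      case True
      have "min c1 c2 * e ?V (max s 2) \<le> c1 * e ?V (max s 2)"
        by (intro mult_right_mono e0) auto
      then show ?thesis
        using 1(3)[OF I u True] True by (simp add: e_def)
    next
      case False
      have "min c1 c2 * e ?V (max s 2) \<le> c2 * e ?V (max s 2)"
        by (intro mult_right_mono e0) auto
      also have "\<dots> \<le> lp_bregman p s I u v"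
        using 2(3)[OF I u, of v] False by (simp add: e_def)
      finally show ?thesis .
    qed
    have hi: "lp_bregman p s I u v \<le> max C1 C2 * e ?V (min s 2)"
    proof (cases "?V \<le> 3")
      case True
      have "C1 * e ?V (min s 2) \<le> max C1 C2 * e ?V (min s 2)"
        by (intro mult_right_mono e0) auto
      then show ?thesis
        using 1(4)[OF I u True] True by (simp add: e_def)
    next
      case False
      have "lp_bregman p s I u v \<le> C2 * e ?V (min s 2)"
        using 2(4)[OF I u, of v] False by (simp add: e_def)
      also have "\<dots> \<le> max C1 C2 * e ?V (min s 2)"
        by (intro mult_right_mono e0) auto
      finally show ?thesis .
    qed
    have "min c1 c2 / A (max s 2) * (?V powr max s 2 * (?V + 1) powr (p - max s 2))
        \<le> min c1 c2 / A (max s 2) * (A (max s 2) * e ?V (max s 2))"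
      using 1 2 A[of "max s 2"] by (intro mult_left_mono e) auto
    also have "\<dots> = min c1 c2 * e ?V (max s 2)"
      using A[of "max s 2"] by simp
    finally show "min c1 c2 / A (max s 2) * (?V powr max s 2 * (?V + 1) powr (p - max s 2))
        \<le> lp_bregman p s I u v"
      using lo by linarith
    have "max C1 C2 * e ?V (min s 2)
        \<le> max C1 C2 * (A (min s 2) * (?V powr min s 2 * (?V + 1) powr (p - min s 2)))"
      using 1 2 by (intro mult_left_mono e) auto
    then show "lp_bregman p s I u v
        \<le> max C1 C2 * A (min s 2) * (?V powr min s 2 * (?V + 1) powr (p - min s 2))"
      using hi by (simp add: mult.assoc)
  qed
qed

section \<open>Homogeneity and arbitrary base vectors\<close>

text \<open>Under joint scaling the pairing has degree \<open>s\<close> and its prefactor degree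
  \<open>p - s\<close>, so every term has degree \<open>p\<close>.\<close>

lemma lp_bregman_scale:
  assumes k: "0 < k" and s: "0 < s"
  shows "lp_bregman p s I (\<lambda>i. k * u i) (\<lambda>i. k * v i) = k powr p * lp_bregman p s I u v"
proof -
  have "lp_pairing s I (\<lambda>i. k * u i) (\<lambda>i. k * v i) = k powr s * lp_pairing s I u v"
    using k by (simp add: lp_pairing_def abs_mult powr_mult powr_eq_square_mult[of k s]
        sum_distrib_left power2_eq_square mult_ac)
  moreover have "lp_norm s I (\<lambda>i. k * u i + k * v i) = k * lp_norm s I (\<lambda>i. u i + v i)"
    using k s lp_norm_scale[OF s, of I k "\<lambda>i. u i + v i"] by (simp add: distrib_left)
  moreover have "k powr (p - s) * k powr s = k powr p"
    using k by (simp flip: powr_add)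
  then have "p * (k powr (p - s) * lp_norm s I u powr (p - s)) * (k powr s * lp_pairing s I u v)
      = k powr p * (p * lp_norm s I u powr (p - s) * lp_pairing s I u v)"
    by (simp add: mult_ac)
  ultimately show ?thesis
    using k s by (simp add: lp_bregman_def lp_norm_scale powr_mult right_diff_distrib)
qed

lemma lp_bregman_bounds:
  assumes p: "1 < p" and s: "1 < s"
  obtains c C where "0 < c" "0 < C"
    "\<And>(I :: 'a set) x y. finite I
      \<Longrightarrow> c * (lp_norm s I y powr max s 2 * (lp_norm s I y + lp_norm s I x) powr (p - max s 2))
        \<le> lp_bregman p s I x y"
    "\<And>(I :: 'a set) x y. finite I
      \<Longrightarrow> lp_bregman p s I x y
        \<le> C * (lp_norm s I y powr min s 2 * (lp_norm s I y + lp_norm s I x) powr (p - min s 2))"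
proof -
  obtain c C where c: "0 < c" "0 < C" and
    lo: "\<And>(I :: 'a set) u v. \<lbrakk>finite I; lp_norm s I u = 1\<rbrakk>
      \<Longrightarrow> c * (lp_norm s I v powr max s 2 * (lp_norm s I v + 1) powr (p - max s 2))
        \<le> lp_bregman p s I u v" and
    hi: "\<And>(I :: 'a set) u v. \<lbrakk>finite I; lp_norm s I u = 1\<rbrakk>
      \<Longrightarrow> lp_bregman p s I u v
        \<le> C * (lp_norm s I v powr min s 2 * (lp_norm s I v + 1) powr (p - min s 2))"
    using lp_bregman_bounds_normalized[OF p s] by blast
  have main: "min c 1 * (lp_norm s I y powr max s 2 * (lp_norm s I y + lp_norm s I x) powr (p - max s 2))
        \<le> lp_bregman p s I x y \<and>
      lp_bregman p s I x y
        \<le> max C 1 * (lp_norm s I y powr min s 2 * (lp_norm s I y + lp_norm s I x) powr (p - min s 2))"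
    if I: "finite I" for I :: "'a set" and x y
  proof (cases "lp_norm s I x = 0")
    case True
    \<comment> \<open>At a vanishing base vector the distance and both comparison expressions equal
      \<open>lp_norm s I y powr p\<close>, so the constant \<open>1\<close> works; hence
      \<open>min c 1\<close> and \<open>max C 1\<close>.\<close>
    have "\<forall>i\<in>I. x i = 0"
      using True s I by (simp add: lp_norm_eq_0)
    then have "lp_norm s I (\<lambda>i. x i + y i) = lp_norm s I y"
      by (simp add: lp_norm_def)
    then have D: "lp_bregman p s I x y = lp_norm s I y powr p"
      using True by (simp add: lp_bregman_def)
    have E: "lp_norm s I y powr q * lp_norm s I y powr (p - q) = lp_norm s I y powr p" for q
      by (simp flip: powr_add)
    have "min c 1 * lp_norm s I y powr p \<le> 1 * lp_norm s I y powr p"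
      "1 * lp_norm s I y powr p \<le> max C 1 * lp_norm s I y powr p"
      by (intro mult_right_mono; simp)+
    then show ?thesis
      by (simp add: True D E)
  next
    case False
    define k where "k = lp_norm s I x"
    have k: "0 < k"
      using False lp_norm_nonneg[of s I x] unfolding k_def by linarith
    define u v where "u = (\<lambda>i. (1 / k) * x i)" and "v = (\<lambda>i. (1 / k) * y i)"
    have u: "lp_norm s I u = 1"
      unfolding u_def using s k by (subst lp_norm_scale) (auto simp: k_def)
    have y: "lp_norm s I y = k * lp_norm s I v"
      unfolding v_def using s k by (subst lp_norm_scale) auto
    have D: "lp_bregman p s I x y = k powr p * lp_bregman p s I u v"
      using lp_bregman_scale[of k s p I u v] s k by (simp add: u_def v_def)
    \<comment> \<open>The comparison expression has degree \<open>q + (p - q) = p\<close>, the same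
      as the distance, so the power of \<open>k\<close> cancels from both inequalities.\<close>
    have G: "lp_norm s I y powr q * (lp_norm s I y + lp_norm s I x) powr (p - q)
        = k powr p * (lp_norm s I v powr q * (lp_norm s I v + 1) powr (p - q))" for q
    proof -
      have "lp_norm s I y + lp_norm s I x = k * (lp_norm s I v + 1)"
        by (simp add: y k_def[symmetric] distrib_left)
      then have "lp_norm s I y powr q * (lp_norm s I y + lp_norm s I x) powr (p - q)
        = (k powr q * k powr (p - q)) * (lp_norm s I v powr q * (lp_norm s I v + 1) powr (p - q))"
        using k by (simp add: y powr_mult)
      then show ?thesis
        using k by (simp flip: powr_add)
    qed
    have W: "0 \<le> lp_norm s I v powr q * (lp_norm s I v + 1) powr (p - q)" for q
      by simp
    have "min c 1 * (lp_norm s I v powr max s 2 * (lp_norm s I v + 1) powr (p - max s 2))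
        \<le> lp_bregman p s I u v"
      by (rule order_trans[OF mult_right_mono[OF _ W] lo[OF I u]]) simp
    moreover have "lp_bregman p s I u v
        \<le> max C 1 * (lp_norm s I v powr min s 2 * (lp_norm s I v + 1) powr (p - min s 2))"
      by (rule order_trans[OF hi[OF I u] mult_right_mono[OF _ W]]) simp
    ultimately show ?thesis
      unfolding G D mult.left_commute[of _ "k powr p"]
      by (intro conjI mult_left_mono) auto
  qed
  show ?thesis
    by (rule that[of "min c 1" "max C 1"]) (use main c in auto)
qed

section \<open>Absorption of the weights\<close>

text \<open>Multiplying each coordinate by the \<open>s\<close>-th root of its positive weight
  reproduces the weight after taking the power \<open>s\<close>.\<close>

lemma wnorm_eq_lp_norm:
  assumes "0 < s" "\<And>i. i < n \<Longrightarrow> 0 < a i x"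
  shows "wnorm n s a x \<xi> = lp_norm s {..<n} (\<lambda>i. a i x powr (1 / s) * \<xi> i)"
  using assms by (simp add: wnorm_def lp_norm_def abs_mult powr_mult powr_powr less_imp_le)

lemma bregman_eq_lp_bregman:
  assumes s: "0 < s" and a: "\<And>i. i < n \<Longrightarrow> 0 < a i x"
  shows "bregman n p s a x (Rn_add n \<xi> \<eta>) \<xi>
    = lp_bregman p s {..<n} (\<lambda>i. a i x powr (1 / s) * \<xi> i) (\<lambda>i. a i x powr (1 / s) * \<eta> i)"
proof -
  have "wnorm n s a x (Rn_add n \<xi> \<eta>)
      = lp_norm s {..<n} (\<lambda>i. a i x powr (1 / s) * \<xi> i + a i x powr (1 / s) * \<eta> i)"
    by (simp add: wnorm_eq_lp_norm[where a = a and x = x, OF s a] lp_norm_def Rn_add_def distrib_left)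
  moreover have "(\<Sum>i<n. a i x * (\<bar>\<xi> i\<bar> powr (s - 2) * \<xi> i) * (Rn_add n \<xi> \<eta> i - \<xi> i))
      = lp_pairing s {..<n} (\<lambda>i. a i x powr (1 / s) * \<xi> i) (\<lambda>i. a i x powr (1 / s) * \<eta> i)"
    unfolding lp_pairing_def
  proof (rule sum.cong[OF refl])
    fix i
    assume i: "i \<in> {..<n}"
    \<comment> \<open>The weight \<open>b powr s\<close> is distributed over the three factors of
      the pairing as \<open>b powr (s - 2)\<close>, \<open>b\<close> and \<open>b\<close>.\<close>
    define b where "b = a i x powr (1 / s)"
    have b: "0 < b" "a i x = b powr s"
      using a[of i] i s by (auto simp: b_def powr_powr)
    show "a i x * (\<bar>\<xi> i\<bar> powr (s - 2) * \<xi> i) * (Rn_add n \<xi> \<eta> i - \<xi> i)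
        = \<bar>a i x powr (1 / s) * \<xi> i\<bar> powr (s - 2) * (a i x powr (1 / s) * \<xi> i) * (a i x powr (1 / s) * \<eta> i)"
      unfolding b_def[symmetric] unfolding b(2) using i b(1)
      by (simp add: Rn_add_def abs_mult powr_mult powr_eq_square_mult[of b s] power2_eq_square mult_ac)
  qed
  ultimately show ?thesis
    by (simp add: bregman_def lp_bregman_def wnorm_eq_lp_norm[where a = a and x = x, OF s a])
qed

theorem lemma3p12:
  fixes p s :: real
  assumes "1 < p" and "1 < s"
  shows "\<exists>c C :: real. 0 < c \<and> 0 < C \<and>
    (\<forall>(n::nat) (\<Omega> :: (nat \<Rightarrow> real) set) (a :: nat \<Rightarrow> (nat \<Rightarrow> real) \<Rightarrow> real).
      2 \<le> n \<longrightarrow> is_domain n \<Omega> \<longrightarrow> weight_vector n \<Omega> a \<longrightarrow>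
      (AE x\<in>\<Omega> in Rn_leb n. \<forall>\<xi>\<in>Rn n. \<forall>\<eta>\<in>Rn n.
         c * (wnorm n s a x \<eta> powr (max s 2) *
              (wnorm n s a x \<eta> + wnorm n s a x \<xi>) powr (p - max s 2))
           \<le> bregman n p s a x (Rn_add n \<xi> \<eta>) \<xi> \<and>
         bregman n p s a x (Rn_add n \<xi> \<eta>) \<xi>
           \<le> C * (wnorm n s a x \<eta> powr (min s 2) *
                  (wnorm n s a x \<eta> + wnorm n s a x \<xi>) powr (p - min s 2))))"
proof -
  \<comment> \<open>The constants are obtained before \<open>n\<close>, \<open>\<Omega>\<close> and
    \<open>a\<close> are introduced, so they depend on \<open>p\<close> and \<open>s\<close>
    only.\<close>
  obtain c C where c: "0 < c" "0 < C" and
    lo: "\<And>(I :: nat set) x y. finite I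
      \<Longrightarrow> c * (lp_norm s I y powr max s 2 * (lp_norm s I y + lp_norm s I x) powr (p - max s 2))
        \<le> lp_bregman p s I x y" and
    hi: "\<And>(I :: nat set) x y. finite I
      \<Longrightarrow> lp_bregman p s I x y
        \<le> C * (lp_norm s I y powr min s 2 * (lp_norm s I y + lp_norm s I x) powr (p - min s 2))"
    using lp_bregman_bounds[OF assms] by blast
  have s: "0 < s" using assms by simp
  show ?thesis
  proof (intro exI conjI allI impI)
    fix n :: nat and \<Omega> :: "(nat \<Rightarrow> real) set" and a :: "nat \<Rightarrow> (nat \<Rightarrow> real) \<Rightarrow> real"
    assume "weight_vector n \<Omega> a"
    then have pos: "0 < a i x" if "i < n" "x \<in> \<Omega>" for i x
      using that by (auto simp: weight_vector_def)
    show "AE x\<in>\<Omega> in Rn_leb n. \<forall>\<xi>\<in>Rn n. \<forall>\<eta>\<in>Rn n.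
         c * (wnorm n s a x \<eta> powr (max s 2) *
              (wnorm n s a x \<eta> + wnorm n s a x \<xi>) powr (p - max s 2))
           \<le> bregman n p s a x (Rn_add n \<xi> \<eta>) \<xi> \<and>
         bregman n p s a x (Rn_add n \<xi> \<eta>) \<xi>
           \<le> C * (wnorm n s a x \<eta> powr (min s 2) *
                  (wnorm n s a x \<eta> + wnorm n s a x \<xi>) powr (p - min s 2))"
    \<comment> \<open>The estimate is pointwise: all weights are positive at each
      \<open>x \<in> \<Omega>\<close>, which yields it there and hence almost everywhere.\<close>
    proof (intro AE_I2 impI ballI)
      fix x \<xi> \<eta> :: "nat \<Rightarrow> real"
      assume x: "x \<in> \<Omega>"
      show "c * (wnorm n s a x \<eta> powr (max s 2) *
              (wnorm n s a x \<eta> + wnorm n s a x \<xi>) powr (p - max s 2))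
           \<le> bregman n p s a x (Rn_add n \<xi> \<eta>) \<xi> \<and>
         bregman n p s a x (Rn_add n \<xi> \<eta>) \<xi>
           \<le> C * (wnorm n s a x \<eta> powr (min s 2) *
                  (wnorm n s a x \<eta> + wnorm n s a x \<xi>) powr (p - min s 2))"
        using lo[OF finite_lessThan] hi[OF finite_lessThan]
        by (simp only: wnorm_eq_lp_norm[where a = a and x = x, OF s pos[OF _ x]]
            bregman_eq_lp_bregman[where a = a and x = x, OF s pos[OF _ x]] simp_thms)
    qed
  qed (use c in auto)
qed

end
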